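(* Let $\hat{C}=(\hat{V},\hat{N},\hat{P})$ be an abstract component with layout $\mathit{C}$, and let $\hat{C}'$ be the output of the algorithm Abstract-C on $\hat{C}$ (for any choices made during its execution), regarded as an abstract component with layout $\mathit{C}$. Then $\hat{C}'$ is a valid abstraction of $\hat{C}$.
   Context: An abstract component is a directed graph $(\hat{V},\hat{N},\hat{P})$ with a layout attribute in $\{\mathit{SLL},\mathit{T},\mathit{C},\mathit{DAG}\}$; $\hat{V}$ is a finite set of variables, $\hat{N}$ a finite set of nodes, and for layout $\mathit{C}$ (cycle) $\hat{P}\subseteq(\hat{V}\times\hat{N})\cup(\hat{N}\times\hat{N})$. For $n\in\hat{N}$ let $P_{in}(\{n\})=\{(x,n)\in\hat{P}\mid x\in\hat{N}\setminus\{n\}\}$ and $P_{out}(\{n\})=\{(n,x)\in\hat{P}\mid x\in\hat{N}\setminus\{n\}\}$. A node $n$ is special if $(v,n)\in\hat{P}$ for some $v\in\hat{V}$, or $|P_{in}(\{n\})|>1$, or $|P_{out}(\{n\})|>1$; otherwise it is ordinary. Algorithm Abstract-C: (1) $M\leftarrow$ the set of ordinary nodes of $\hat{N}$; (2) while there are $a,b\in M$ with $a\neq b$ and $(a,b)\in\hat{P}$: (i) while there exists $(b,c)\in\hat{P}$: $\hat{P}\leftarrow(\hat{P}\setminus\{(b,c)\})\cup\{(a,c)\}$; (ii) $\hat{N}\leftarrow\hat{N}\setminus\{b\}$; (iii) $\hat{P}\leftarrow(\hat{P}\setminus\{(a,b)\})\cup\{(a,a)\}$; (iv) $M\leftarrow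 M\setminus\{b\}$; (3) return $(\hat{V},\hat{N},\hat{P})$. An abstract component $\hat{C}'=(\hat{V}',\hat{N}',\hat{P}')$ is a valid abstraction of $\hat{C}=(\hat{V},\hat{N},\hat{P})$ if they have the same layout, $\hat{V}'=\hat{V}$, and there are onto maps $f_N:\hat{N}\to\hat{N}'$ and $f_P:\hat{P}\to\hat{P}'$ such that: (1) for every $(v,n')\in\hat{P}'$ with $v\in\hat{V}'$, $f_P^{-1}((v,n'))\subseteq\{(v,n)\in\hat{P}\mid n\in f_N^{-1}(n')\}$; (2) for every $(n',m')\in\hat{P}'$ with $n',m'\in\hat{N}'$, $f_P^{-1}((n',m'))\subseteq\{(n,m)\in\hat{P}\mid n\in f_N^{-1}(n'),\ m\in f_N^{-1}(m')\}$; (3) for every $(n',m',x)\in\hat{P}'$ with $x\in\{l,r\}$, $f_P^{-1}((n',m',x))\subseteq\{(n,m,x)\in\hat{P}\mid n\in f_N^{-1}(n'),\ m\in f_N^{-1}(m')\}$. *)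

theory Defs
  imports Main
begin

datatype layout = SLL | Tree | Cycle | DAG

datatype dir = Lft | Rgt

text \<open>
  The three shapes of edges \<open>(v,n)\<close>, \<open>(n,m)\<close> and \<open>(n,m,x)\<close> with \<open>x\<close> one of \<open>l\<close>, \<open>r\<close>.
  Variables and nodes have different types, so they are never confused.
\<close>
datatype ('v, 'n) edge =
    VarEdge 'v 'n
  | NodeEdge 'n 'n
  | DirEdge 'n 'n dir

record ('v, 'n) component =
  layout :: layout
  vars :: "'v set"
  nodes :: "'n set"
  edges :: "('v, 'n) edge set"

text \<open>
  Labelled edges are excluded for cycles only; nothing is prescribed about which of the
  edge shapes the other layouts use.
\<close>
definition abstract_component :: "('v, 'n) component \<Rightarrow> bool" where
  "abstract_component C \<longleftrightarrow>
     finite (vars C) \<and> finite (nodes C) \<and>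
     edges C \<subseteq> {VarEdge v n | v n. v \<in> vars C \<and> n \<in> nodes C}
              \<union> {NodeEdge n m | n m. n \<in> nodes C \<and> m \<in> nodes C}
              \<union> {DirEdge n m x | n m x. n \<in> nodes C \<and> m \<in> nodes C} \<and>
     (layout C = Cycle \<longrightarrow>
        edges C \<subseteq> {VarEdge v n | v n. v \<in> vars C \<and> n \<in> nodes C}
                 \<union> {NodeEdge n m | n m. n \<in> nodes C \<and> m \<in> nodes C})"

definition P_in :: "('v, 'n) component \<Rightarrow> 'n \<Rightarrow> ('v, 'n) edge set" where
  "P_in C n = {NodeEdge x n | x. NodeEdge x n \<in> edges C \<and> x \<in> nodes C - {n}}"

definition P_out :: "('v, 'n) component \<Rightarrow> 'n \<Rightarrow> ('v, 'n) edge set" where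
  "P_out C n = {NodeEdge n x | x. NodeEdge n x \<in> edges C \<and> x \<in> nodes C - {n}}"

definition special :: "('v, 'n) component \<Rightarrow> 'n \<Rightarrow> bool" where
  "special C n \<longleftrightarrow>
     (\<exists>v\<in>vars C. VarEdge v n \<in> edges C) \<or> card (P_in C n) > 1 \<or> card (P_out C n) > 1"

definition ordinary_nodes :: "('v, 'n) component \<Rightarrow> 'n set" where
  "ordinary_nodes C = {n \<in> nodes C. \<not> special C n}"

text \<open>
  Terminating runs of a loop with guard \<open>B\<close> and a nondeterministic body \<open>S\<close>,
  relating the initial state to the final state.
\<close>
inductive while_run :: "('s \<Rightarrow> bool) \<Rightarrow> ('s \<Rightarrow> 's \<Rightarrow> bool) \<Rightarrow> 's \<Rightarrow> 's \<Rightarrow> bool"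
  for B :: "'s \<Rightarrow> bool" and S :: "'s \<Rightarrow> 's \<Rightarrow> bool" where
  while_exit: "\<not> B s \<Longrightarrow> while_run B S s s"
| while_iter: "B s \<Longrightarrow> S s s' \<Longrightarrow> while_run B S s' t \<Longrightarrow> while_run B S s t"

definition redirect_guard :: "'n \<Rightarrow> ('v, 'n) edge set \<Rightarrow> bool" where
  "redirect_guard b P \<longleftrightarrow> (\<exists>c. NodeEdge b c \<in> P)"

definition redirect_body ::
  "'n \<Rightarrow> 'n \<Rightarrow> ('v, 'n) edge set \<Rightarrow> ('v, 'n) edge set \<Rightarrow> bool" where
  "redirect_body a b P P' \<longleftrightarrow>
     (\<exists>c. NodeEdge b c \<in> P \<and> P' = (P - {NodeEdge b c}) \<union> {NodeEdge a c})"

text \<open>The loop state is the triple of the current nodes, the current edges and the set \<open>M\<close>.\<close>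
type_synonym ('v, 'n) state = "'n set \<times> ('v, 'n) edge set \<times> 'n set"

fun merge_guard :: "('v, 'n) state \<Rightarrow> bool" where
  "merge_guard (N, P, M) \<longleftrightarrow> (\<exists>a\<in>M. \<exists>b\<in>M. a \<noteq> b \<and> NodeEdge a b \<in> P)"

fun merge_body :: "('v, 'n) state \<Rightarrow> ('v, 'n) state \<Rightarrow> bool" where
  "merge_body (N, P, M) (N', P', M') \<longleftrightarrow>
     (\<exists>a\<in>M. \<exists>b\<in>M. a \<noteq> b \<and> NodeEdge a b \<in> P \<and>
        (\<exists>Q. while_run (redirect_guard b) (redirect_body a b) P Q \<and>
             N' = N - {b} \<and>
             P' = (Q - {NodeEdge a b}) \<union> {NodeEdge a a} \<and>
             M' = M - {b}))"

definition Abstract_C :: "('v, 'n) component \<Rightarrow> ('v, 'n) component \<Rightarrow> bool" where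
  "Abstract_C C C' \<longleftrightarrow>
     (\<exists>N' P' M'.
        while_run merge_guard merge_body (nodes C, edges C, ordinary_nodes C) (N', P', M') \<and>
        C' = \<lparr>layout = Cycle, vars = vars C, nodes = N', edges = P'\<rparr>)"

definition valid_abstraction :: "('v, 'n) component \<Rightarrow> ('v, 'n) component \<Rightarrow> bool" where
  "valid_abstraction C' C \<longleftrightarrow>
     abstract_component C \<and> abstract_component C' \<and>
     layout C' = layout C \<and> vars C' = vars C \<and>
     (\<exists>(f\<^sub>N :: 'n \<Rightarrow> 'n) (f\<^sub>P :: ('v, 'n) edge \<Rightarrow> ('v, 'n) edge).
        f\<^sub>N ` nodes C = nodes C' \<and>
        f\<^sub>P ` edges C = edges C' \<and>
        (\<forall>v\<in>vars C'. \<forall>n'. VarEdge v n' \<in> edges C' \<longrightarrow>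
           {e \<in> edges C. f\<^sub>P e = VarEdge v n'}
             \<subseteq> {VarEdge v n | n. VarEdge v n \<in> edges C \<and> n \<in> {k \<in> nodes C. f\<^sub>N k = n'}}) \<and>
        (\<forall>n'\<in>nodes C'. \<forall>m'\<in>nodes C'. NodeEdge n' m' \<in> edges C' \<longrightarrow>
           {e \<in> edges C. f\<^sub>P e = NodeEdge n' m'}
             \<subseteq> {NodeEdge n m | n m. NodeEdge n m \<in> edges C \<and>
                  n \<in> {k \<in> nodes C. f\<^sub>N k = n'} \<and> m \<in> {k \<in> nodes C. f\<^sub>N k = m'}}) \<and>
        (\<forall>n' m' x. DirEdge n' m' x \<in> edges C' \<longrightarrow>
           {e \<in> edges C. f\<^sub>P e = DirEdge n' m' x}
             \<subseteq> {DirEdge n m x | n m. DirEdge n m x \<in> edges C \<and>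
                  n \<in> {k \<in> nodes C. f\<^sub>N k = n'} \<and> m \<in> {k \<in> nodes C. f\<^sub>N k = m'}}))"

end

theory Submission
  imports Defs
begin

text \<open>
  Merging an ordinary node \<open>b\<close> into its ordinary predecessor \<open>a\<close> is the graph quotient induced by
  the node map that sends \<open>b\<close> to \<open>a\<close> and fixes everything else. Redirecting the outgoing edges of
  \<open>b\<close> agrees with that quotient because \<open>b\<close> has no incoming edge besides \<open>(a,b)\<close> and possibly a
  self-loop: no variable points to \<open>b\<close>, and \<open>a\<close> is its only other predecessor. This
  property of the nodes in \<open>M\<close> survives each merge, so the output is the image of the input under
  the composition of these node maps.
\<close>

text \<open>The loop invariant on \<open>M\<close>. Uniqueness of the foreign predecessor replaces a
  bound on a cardinality, which makes it easy to transport along edge maps. Self-loops are exempt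
  because every merge creates one.\<close>

definition few_in_edges :: "('v, 'n) edge set \<Rightarrow> 'n set \<Rightarrow> bool" where
  "few_in_edges P M \<longleftrightarrow>
     (\<forall>n\<in>M. (\<forall>v. VarEdge v n \<notin> P) \<and>
       (\<forall>x y. NodeEdge x n \<in> P \<longrightarrow> NodeEdge y n \<in> P \<longrightarrow> x \<noteq> n \<longrightarrow> y \<noteq> n \<longrightarrow> x = y))"

definition cycle_edges :: "'v set \<Rightarrow> 'n set \<Rightarrow> ('v, 'n) edge set" where
  "cycle_edges V N = {VarEdge v n | v n. v \<in> V \<and> n \<in> N}
                   \<union> {NodeEdge n m | n m. n \<in> N \<and> m \<in> N}"

lemma VarEdge_in_cycle_edges [simp]: "VarEdge v n \<in> cycle_edges V N \<longleftrightarrow> v \<in> V \<and> n \<in> N"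
  and NodeEdge_in_cycle_edges [simp]: "NodeEdge n m \<in> cycle_edges V N \<longleftrightarrow> n \<in> N \<and> m \<in> N"
  and DirEdge_in_cycle_edges [simp]: "DirEdge n m x \<notin> cycle_edges V N"
  by (auto simp: cycle_edges_def)

text \<open>\<open>map_edge id g\<close> is the edge map induced by the node map \<open>g\<close>:
  it keeps the variable and the shape of an edge and renames its nodes.\<close>

lemma map_edge_cycle_edges:
  assumes "P \<subseteq> cycle_edges V N"
  shows "map_edge id g ` P \<subseteq> cycle_edges V (g ` N)"
proof
  fix e assume "e \<in> map_edge id g ` P"
  then obtain e0 where "e0 \<in> cycle_edges V N" "e = map_edge id g e0"
    using assms by auto
  then show "e \<in> cycle_edges V (g ` N)"
    by (cases e0) auto
qed

lemma few_in_edges_ordinary_nodes: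
  assumes "finite (nodes C)" "edges C \<subseteq> cycle_edges (vars C) (nodes C)"
  shows "few_in_edges (edges C) (ordinary_nodes C)"
  unfolding few_in_edges_def
proof (intro ballI conjI allI impI)
  fix n v assume "n \<in> ordinary_nodes C"
  then show "VarEdge v n \<notin> edges C"
    using assms(2) by (auto simp: ordinary_nodes_def special_def)
next
  fix n x y
  assume n: "n \<in> ordinary_nodes C"
    and e: "NodeEdge x n \<in> edges C" "NodeEdge y n \<in> edges C" "x \<noteq> n" "y \<noteq> n"
  have "P_in C n \<subseteq> (\<lambda>x. NodeEdge x n) ` nodes C"
    by (auto simp: P_in_def)
  \<comment> \<open>An infinite set has \<open>card\<close> 0, so the bound on \<open>card\<close>
    yields uniqueness only once finiteness is known.\<close>
  then have "finite (P_in C n)"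
    using assms(1) by (meson finite_imageI finite_subset)
  moreover have "NodeEdge x n \<in> P_in C n" "NodeEdge y n \<in> P_in C n"
    using e assms(2) by (auto simp: P_in_def)
  moreover have "card (P_in C n) \<le> Suc 0"
    using n by (auto simp: ordinary_nodes_def special_def)
  ultimately show "x = y"
    by (auto simp: card_le_Suc0_iff_eq)
qed

text \<open>The order of the choices is irrelevant: each iteration moves one edge from
  \<open>b\<close> to \<open>a\<close>, and since \<open>a \<noteq> b\<close> the new edge does not
  leave \<open>b\<close> again. A self-loop at \<open>b\<close> turns into
  \<open>NodeEdge a b\<close>.\<close>

lemma redirect_run_result:
  assumes "while_run (redirect_guard b) (redirect_body a b) P Q" "a \<noteq> b"
  shows "Q = P - range (NodeEdge b) \<union> {NodeEdge a c | c. NodeEdge b c \<in> P}"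
  using assms
proof (induction rule: while_run.induct)
  case (while_exit P)
  then show ?case
    by (auto simp: redirect_guard_def)
next
  case (while_iter P P1 Q)
  then show ?case
    by (fastforce simp: redirect_body_def)
qed

lemma merge_edges_eq_image:
  assumes P: "P \<subseteq> cycle_edges V N" and few: "few_in_edges P M"
    and "a \<noteq> b" "b \<in> M" "NodeEdge a b \<in> P"
    and run: "while_run (redirect_guard b) (redirect_body a b) P Q"
  shows "Q - {NodeEdge a b} \<union> {NodeEdge a a} = map_edge id (id(b := a)) ` P"
    (is "?P' = ?f ` P")
proof -
  have Q: "Q = P - range (NodeEdge b) \<union> {NodeEdge a c | c. NodeEdge b c \<in> P}"
    using redirect_run_result[OF run \<open>a \<noteq> b\<close>] .
  have no_var: "VarEdge v b \<notin> P" for v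
    using few \<open>b \<in> M\<close> by (auto simp: few_in_edges_def)
  have pred: "x = a \<or> x = b" if "NodeEdge x b \<in> P" for x
    using few \<open>b \<in> M\<close> \<open>NodeEdge a b \<in> P\<close> \<open>a \<noteq> b\<close> that by (auto simp: few_in_edges_def)
  \<comment> \<open>This image is the loop at \<open>a\<close> that the algorithm adds.\<close>
  have image: "?f (NodeEdge a b) \<in> ?f ` P"
    using \<open>NodeEdge a b \<in> P\<close> by blast
  show ?thesis
  proof
    show "?f ` P \<subseteq> ?P'"
    proof (rule image_subsetI)
      fix e assume "e \<in> P"
      then show "?f e \<in> ?P'"
        using P no_var pred \<open>a \<noteq> b\<close> by (cases e) (auto simp: Q)
    qed
    show "?P' \<subseteq> ?f ` P"
    proof
      fix e assume "e \<in> ?P'"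
      \<comment> \<open>An edge is the added loop, an untouched edge or a redirected one. A
        redirected self-loop of \<open>b\<close> equals the deleted \<open>NodeEdge a b\<close>,
        hence \<open>c \<noteq> b\<close>.\<close>
      then consider "e = NodeEdge a a"
        | "e \<in> P" "e \<notin> range (NodeEdge b)" "e \<noteq> NodeEdge a b"
        | c where "NodeEdge b c \<in> P" "e = NodeEdge a c" "c \<noteq> b"
        by (auto simp: Q)
      then show "e \<in> ?f ` P"
      proof cases
        case 1
        then show ?thesis using image \<open>a \<noteq> b\<close> by simp
      next
        case 2
        \<comment> \<open>An untouched edge avoids \<open>b\<close>: the only edges into
          \<open>b\<close> come from \<open>a\<close> or from \<open>b\<close> itself, and both are
          excluded here.\<close>
        then have "?f e = e"
          using P no_var pred by (cases e) auto
        then show ?thesis using 2 by (metis imageI)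
      next
        case 3
        then have "?f (NodeEdge b c) = e" by simp
        then show ?thesis using 3 by (metis imageI)
      qed
    qed
  qed
qed

text \<open>Only \<open>a\<close> receives new incoming edges, namely those of \<open>b\<close>.
  These start at \<open>a\<close> or \<open>b\<close>, so they become loops at \<open>a\<close> and
  add no foreign predecessor. No variable points to \<open>b\<close>, so none is passed on to
  \<open>a\<close>.\<close>

lemma few_in_edges_merge:
  assumes few: "few_in_edges P M" and M: "a \<in> M" "b \<in> M" "a \<noteq> b" "NodeEdge a b \<in> P"
  shows "few_in_edges (map_edge id (id(b := a)) ` P) (M - {b})"
proof -
  let ?g = "id(b := a)"
  have var: "\<exists>m. VarEdge v m \<in> P \<and> ?g m = n" if e: "VarEdge v n \<in> map_edge id ?g ` P" for v n
  proof -
    obtain e where "e \<in> P" "VarEdge v n = map_edge id ?g e"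
      using e by blast
    then show ?thesis by (cases e) auto
  qed
  have node: "\<exists>m k. NodeEdge m k \<in> P \<and> ?g m = x \<and> ?g k = n"
    if e: "NodeEdge x n \<in> map_edge id ?g ` P" for x n
  proof -
    obtain e where "e \<in> P" "NodeEdge x n = map_edge id ?g e"
      using e by blast
    then show ?thesis by (cases e) auto
  qed
  have pred: "x = a \<or> x = b" if "NodeEdge x b \<in> P" for x
    using few M that by (auto simp: few_in_edges_def)
  \<comment> \<open>A foreign predecessor after the merge stems from one of the same target before
    it: if the old target were \<open>b\<close>, then \<open>n = a\<close> and \<open>pred\<close>
    would force \<open>x = a\<close>.\<close>
  have old: "\<exists>m. NodeEdge m n \<in> P \<and> m \<noteq> n \<and> ?g m = x"
    if "NodeEdge x n \<in> map_edge id ?g ` P" "x \<noteq> n" "n \<noteq> b" for x n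
  proof -
    obtain m k where "NodeEdge m k \<in> P" "?g m = x" "?g k = n"
      using node[OF \<open>NodeEdge x n \<in> map_edge id ?g ` P\<close>] by blast
    then show ?thesis
      using that(2,3) pred[of m] by (cases "k = b"; cases "m = b") auto
  qed
  show ?thesis
    unfolding few_in_edges_def
  proof (intro ballI conjI allI impI)
    fix n v assume "n \<in> M - {b}"
    then have "\<not> (\<exists>m. VarEdge v m \<in> P \<and> ?g m = n)"
      using few M by (auto simp: few_in_edges_def)
    then show "VarEdge v n \<notin> map_edge id ?g ` P"
      using var by blast
  next
    fix n x y
    assume n: "n \<in> M - {b}"
      and e: "NodeEdge x n \<in> map_edge id ?g ` P" "NodeEdge y n \<in> map_edge id ?g ` P"
      and ne: "x \<noteq> n" "y \<noteq> n"
    obtain m where m: "NodeEdge m n \<in> P" "m \<noteq> n" "?g m = x"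
      using old[OF e(1) ne(1)] n by blast
    obtain k where k: "NodeEdge k n \<in> P" "k \<noteq> n" "?g k = y"
      using old[OF e(2) ne(2)] n by blast
    have "m = k"
      using few n m k by (auto simp: few_in_edges_def)
    then show "x = y" using m k by simp
  qed
qed

lemma merge_run_is_quotient:
  assumes "while_run merge_guard merge_body s t"
    and "s = (N, P, M)" "t = (N', P', M')"
    and "P \<subseteq> cycle_edges V N" "M \<subseteq> N" "few_in_edges P M"
  shows "\<exists>g. g ` N = N' \<and> map_edge id g ` P = P'"
  using assms
proof (induction arbitrary: N P M rule: while_run.induct)
  case (while_exit s)
  then show ?case
    by (intro exI[of _ id]) (simp add: edge.map_id0 flip: id_def)
next
  case (while_iter s s1 t)
  obtain N1 P1 M1 where s1: "s1 = (N1, P1, M1)"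
    by (cases s1)
  obtain a b Q where ab: "a \<in> M" "b \<in> M" "a \<noteq> b" "NodeEdge a b \<in> P"
    and run: "while_run (redirect_guard b) (redirect_body a b) P Q"
    and N1: "N1 = N - {b}" and P1: "P1 = Q - {NodeEdge a b} \<union> {NodeEdge a a}"
    and M1: "M1 = M - {b}"
    using while_iter.hyps(2) while_iter.prems(1) s1 by auto
  let ?g = "id(b := a)"
  have P1': "P1 = map_edge id ?g ` P"
    using merge_edges_eq_image[OF while_iter.prems(3,5) ab(3,2,4) run] P1 by simp
  \<comment> \<open>Uses \<open>M \<subseteq> N\<close>: the value \<open>a\<close> of the merged
    node already lies in \<open>N\<close>.\<close>
  have N1': "N1 = ?g ` N"
    using ab while_iter.prems(4) N1 by auto
  have "P1 \<subseteq> cycle_edges V N1"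
    unfolding P1' N1' by (rule map_edge_cycle_edges[OF while_iter.prems(3)])
  moreover have "few_in_edges P1 M1"
    unfolding P1' M1 by (rule few_in_edges_merge[OF while_iter.prems(5) ab])
  moreover have "M1 \<subseteq> N1"
    using while_iter.prems(4) M1 N1 by auto
  ultimately obtain h where h: "h ` N1 = N'" "map_edge id h ` P1 = P'"
    using while_iter.IH[OF s1 while_iter.prems(2)] by blast
  have "(h \<circ> ?g) ` N = N'"
    using h(1) unfolding N1' by (simp only: image_comp)
  moreover have "map_edge id (h \<circ> ?g) ` P = P'"
    using h(2) unfolding P1' by (simp add: image_image edge.map_comp)
  ultimately show ?case by blast
qed

lemma abstract_component_Cycle_iff:
  assumes "layout C = Cycle"
  shows "abstract_component C \<longleftrightarrow>
    finite (vars C) \<and> finite (nodes C) \<and> edges C \<subseteq> cycle_edges (vars C) (nodes C)"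
  using assms by (auto simp: abstract_component_def cycle_edges_def)

text \<open>The induced edge map preserves constructors and acts on endpoints by \<open>g\<close>,
  so the preimage of an edge consists of edges of the same shape whose endpoints lie in the right
  fibres of \<open>g\<close>.\<close>

lemma valid_abstraction_quotient:
  assumes C: "abstract_component C" "layout C = Cycle"
    and C': "layout C' = Cycle" "vars C' = vars C" "nodes C' = g ` nodes C"
      "edges C' = map_edge id g ` edges C"
  shows "valid_abstraction C' C"
proof -
  have fin: "finite (vars C)" "finite (nodes C)"
    and E: "edges C \<subseteq> cycle_edges (vars C) (nodes C)"
    using C abstract_component_Cycle_iff by blast+
  have comp: "abstract_component C'"
    using fin map_edge_cycle_edges[OF E] by (simp add: abstract_component_Cycle_iff C')
  have var: "{e \<in> edges C. map_edge id g e = VarEdge v n'}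
      \<subseteq> {VarEdge v n | n. VarEdge v n \<in> edges C \<and> n \<in> {k \<in> nodes C. g k = n'}}" for v n'
  proof
    fix e assume "e \<in> {e \<in> edges C. map_edge id g e = VarEdge v n'}"
    then show "e \<in> {VarEdge v n | n. VarEdge v n \<in> edges C \<and> n \<in> {k \<in> nodes C. g k = n'}}"
      using E by (cases e) auto
  qed
  have node: "{e \<in> edges C. map_edge id g e = NodeEdge n' m'}
      \<subseteq> {NodeEdge n m | n m. NodeEdge n m \<in> edges C \<and>
           n \<in> {k \<in> nodes C. g k = n'} \<and> m \<in> {k \<in> nodes C. g k = m'}}" for n' m'
  proof
    fix e assume "e \<in> {e \<in> edges C. map_edge id g e = NodeEdge n' m'}"
    then show "e \<in> {NodeEdge n m | n m. NodeEdge n m \<in> edges C \<and>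
        n \<in> {k \<in> nodes C. g k = n'} \<and> m \<in> {k \<in> nodes C. g k = m'}}"
      using E by (cases e) auto
  qed
  \<comment> \<open>With layout \<open>Cycle\<close> the condition on labelled edges holds
    vacuously.\<close>
  have dir: "DirEdge n' m' x \<notin> edges C'" for n' m' x
    using comp C'(1) by (auto simp: abstract_component_Cycle_iff)
  show ?thesis
    unfolding valid_abstraction_def
    using C comp C'(1,2) C'(3,4)[symmetric] var node dir
    by (intro conjI exI[of _ g] exI[of _ "map_edge id g"] ballI allI impI) (assumption | simp)+
qed

theorem theorem6:
  fixes C C' :: "('v, 'n) component"
  assumes "abstract_component C"
    and "layout C = Cycle"
    and "Abstract_C C C'"
  shows "valid_abstraction C' C"
proof -
  obtain N' P' M' where
    run: "while_run merge_guard merge_body (nodes C, edges C, ordinary_nodes C) (N', P', M')"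
    and C': "C' = \<lparr>layout = Cycle, vars = vars C, nodes = N', edges = P'\<rparr>"
    using assms(3) unfolding Abstract_C_def by blast
  have "finite (nodes C)" and E: "edges C \<subseteq> cycle_edges (vars C) (nodes C)"
    using assms(1,2) abstract_component_Cycle_iff by blast+
  then have "few_in_edges (edges C) (ordinary_nodes C)"
    by (rule few_in_edges_ordinary_nodes)
  moreover have "ordinary_nodes C \<subseteq> nodes C"
    by (auto simp: ordinary_nodes_def)
  ultimately obtain g where "g ` nodes C = N'" "map_edge id g ` edges C = P'"
    using merge_run_is_quotient[OF run refl refl E] by blast
  then show ?thesis
    using assms(1,2) C' by (intro valid_abstraction_quotient[of C C' g]) auto
qed

end
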